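(* Let $0<\nu\le 1$, let $\mathbf{F}_{k,0}\in\mathbb{R}^n$, and let $k\in\{1,\dots,p\}$ be a direction of maximal absolute gradient-correlation at $\mathbf{F}_{k,0}$, i.e. $|\mathbf{X}_k^T(\mathbf{y}-\mathbf{F}_{k,0})|=\max_{1\le i\le p}|\mathbf{X}_i^T(\mathbf{y}-\mathbf{F}_{k,0})|$, with $\mathbf{X}_k^T(\mathbf{y}-\mathbf{F}_{k,0})\ne 0$. Consider the descent along $k$ starting at $\mathbf{F}_{k,0}$ with learning parameter $\nu$, and let $j\ne k$. The number of steps $m_{j,k}$ taken along $k$ so that $j$ becomes more favorable than $k$ at step $m_{j,k}+1$ is the largest integer $m$ such that $$(1-\nu)^{m-1}\ \ge\ \frac{|d_{j,k}-R_{j,k}|}{1-R_{j,k}\,\mathrm{sgn}(d_{j,k}-R_{j,k})}.$$ It follows that for $0<\nu<1$, $$m_{j,k}=\left\lfloor 1+\frac{\log|d_{j,k}-R_{j,k}|-\log\bigl(1-R_{j,k}\,\mathrm{sgn}(d_{j,k}-R_{j,k})\bigr)}{\log(1-\nu)}\right\rfloor .$$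
   Context: $\mathbf{y}=(y_1,\dots,y_n)^T\in\mathbb{R}^n$ is a response vector and $\mathbf{X}=[\mathbf{X}_1,\dots,\mathbf{X}_p]$ is an $n\times p$ real design matrix with columns $\mathbf{X}_k=(x_{1,k},\dots,x_{n,k})^T$. The data are standardized: $\sum_i y_i=0$, $\sum_i x_{i,k}=0$ and $\sum_i x_{i,k}^2=1$ for each $k$. Descent along $k$: for $m\ge1$, $\mathbf{F}_{k,m}=\mathbf{F}_{k,m-1}+\nu\,\rho_{k,m}\mathbf{X}_k$. Along this descent, for every coordinate $i\in\{1,\dots,p\}$ and $m\ge 1$, the gradient-correlation is $\rho_{i,m}=\mathbf{X}_i^T(\mathbf{y}-\mathbf{F}_{k,m-1})$. Favorability: $j$ is more favorable than $k$ at step $m+1$ if $|\rho_{k,m}|\ge|\rho_{j,m}|$ and $|\rho_{k,m+1}|<|\rho_{j,m+1}|$. Notation: $R_{j,k}=\mathbf{X}_j^T\mathbf{X}_k$ and $d_{j,k}=\rho_{j,1}/\rho_{k,1}$ (so $|d_{j,k}|\le 1$ and $|R_{j,k}|\le1$). $\lfloor z\rfloor$ is the largest integer $\le z$, $\mathrm{sgn}(0)=0$, and $0^0=1$. When $d_{j,k}=R_{j,k}$ the convention is $m_{j,k}=\infty$ (with $\log 0=-\infty$ in the displayed formula), meaning $j$ never becomes more favorable than $k$ along the descent. *)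

theory Defs
  imports "HOL-Analysis.Analysis"
begin

text \<open>The design matrix is \<open>X :: real^'p^'n\<close> (\<open>n\<close> rows, \<open>p\<close> columns), so the \<open>k\<close>-th
  column vector is \<open>column k X\<close>.\<close>

definition standardized :: "real^'n \<Rightarrow> real^'p^'n \<Rightarrow> bool" where
  "standardized y X \<longleftrightarrow>
     (\<Sum>i\<in>UNIV. y $ i) = 0 \<and>
     (\<forall>k. (\<Sum>i\<in>UNIV. X $ i $ k) = 0 \<and> (\<Sum>i\<in>UNIV. (X $ i $ k)\<^sup>2) = 1)"

text \<open>\<open>descent y X \<nu> k F0 m\<close> is \<open>F\<^sub>k\<^sub>,\<^sub>m\<close>; the inner product in the recursion is \<open>\<rho>\<^sub>k\<^sub>,\<^sub>m\<^sub>+\<^sub>1\<close>.\<close>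

primrec descent ::
  "real^'n \<Rightarrow> real^'p^'n \<Rightarrow> real \<Rightarrow> 'p \<Rightarrow> real^'n \<Rightarrow> nat \<Rightarrow> real^'n" where
  "descent y X \<nu> k F0 0 = F0"
| "descent y X \<nu> k F0 (Suc m) =
     descent y X \<nu> k F0 m
       + (\<nu> * (column k X \<bullet> (y - descent y X \<nu> k F0 m))) *\<^sub>R column k X"

text \<open>\<open>\<rho>\<^sub>i\<^sub>,\<^sub>m\<close> along the descent in direction \<open>k\<close>; only meaningful for \<open>m \<ge> 1\<close>.\<close>

definition grad_corr ::
  "real^'n \<Rightarrow> real^'p^'n \<Rightarrow> real \<Rightarrow> 'p \<Rightarrow> real^'n \<Rightarrow> 'p \<Rightarrow> nat \<Rightarrow> real" where
  "grad_corr y X \<nu> k F0 i m = column i X \<bullet> (y - descent y X \<nu> k F0 (m - 1))"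

text \<open>\<open>j\<close> is more favorable than \<open>k\<close> at step \<open>m + 1\<close> (note the shift: the last argument is \<open>m\<close>).\<close>

definition more_favorable_next ::
  "real^'n \<Rightarrow> real^'p^'n \<Rightarrow> real \<Rightarrow> 'p \<Rightarrow> real^'n \<Rightarrow> 'p \<Rightarrow> nat \<Rightarrow> bool" where
  "more_favorable_next y X \<nu> k F0 j m \<longleftrightarrow>
     \<bar>grad_corr y X \<nu> k F0 k m\<bar> \<ge> \<bar>grad_corr y X \<nu> k F0 j m\<bar> \<and>
     \<bar>grad_corr y X \<nu> k F0 k (m + 1)\<bar> < \<bar>grad_corr y X \<nu> k F0 j (m + 1)\<bar>"

text \<open>\<open>m\<^sub>j\<^sub>,\<^sub>k\<close>. The infimum of the empty set in \<^typ>\<open>enat\<close> is \<open>\<infinity>\<close>, so the value is \<open>\<infinity>\<close>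
  exactly when \<open>j\<close> never becomes more favorable than \<open>k\<close>.\<close>

definition num_steps ::
  "real^'n \<Rightarrow> real^'p^'n \<Rightarrow> real \<Rightarrow> 'p \<Rightarrow> real^'n \<Rightarrow> 'p \<Rightarrow> enat" where
  "num_steps y X \<nu> k F0 j = Inf {enat m | m. 1 \<le> m \<and> more_favorable_next y X \<nu> k F0 j m}"

text \<open>Logarithm with \<open>log 0 = -\<infinity>\<close> (the library has \<open>ln 0 = 0\<close>); only meaningful for \<open>x \<ge> 0\<close>.\<close>

definition eln :: "real \<Rightarrow> ereal" where
  "eln x = (if x = 0 then -\<infinity> else ereal (ln x))"

definition efloor :: "ereal \<Rightarrow> ereal" where
  "efloor z = (if \<bar>z\<bar> = \<infinity> then z else ereal (of_int \<lfloor>real_of_ereal z\<rfloor>))"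

end

theory Submission
  imports Defs
begin

text \<open>Along the descent \<open>\<rho>\<^sub>k\<^sub>,\<^sub>m = (1 - \<nu>)\<^sup>m\<^sup>-\<^sup>1 \<rho>\<^sub>k\<^sub>,\<^sub>1\<close> and
  \<open>\<rho>\<^sub>j\<^sub>,\<^sub>m = ((d - R) + R (1 - \<nu>)\<^sup>m\<^sup>-\<^sup>1) \<rho>\<^sub>k\<^sub>,\<^sub>1\<close>. If \<open>d \<noteq> R\<close> then \<open>\<bar>R\<bar> < 1\<close>,
  so \<open>\<bar>\<rho>\<^sub>k\<^sub>,\<^sub>m\<bar> < \<bar>\<rho>\<^sub>j\<^sub>,\<^sub>m\<bar>\<close> means exactly \<open>(1 - \<nu>)\<^sup>m\<^sup>-\<^sup>1 < c\<close> with
  \<open>0 < c \<le> 1\<close>, and the decreasing sequence \<open>(1 - \<nu>)\<^sup>m\<close> passes below \<open>c\<close> exactly once.\<close>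

lemma standardized_column_inner_self:
  "standardized y X \<Longrightarrow> column k X \<bullet> column k X = 1"
  by (simp add: standardized_def inner_vec_def column_def power2_eq_square)

text \<open>Equality case of Cauchy-Schwarz; applied to \<open>b\<close> and to \<open>- b\<close>,
  it excludes |R| = 1 when \<open>d \<noteq> R\<close>.\<close>

lemma unit_inner_eq_one:
  fixes a b :: "'a::real_inner"
  assumes "a \<bullet> a = 1" "b \<bullet> b = 1" "a \<bullet> b = 1"
  shows "a = b"
proof -
  have "(a - b) \<bullet> (a - b) = 0"
    using assms by (simp add: inner_diff inner_commute)
  then show ?thesis by simp
qed

lemma unit_inner_abs_le_one:
  fixes a b :: "'a::real_inner"
  assumes "a \<bullet> a = 1" "b \<bullet> b = 1"
  shows "\<bar>a \<bullet> b\<bar> \<le> 1"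
  using Cauchy_Schwarz_ineq2[of a b] assms by (simp add: norm_eq_sqrt_inner)

text \<open>A step subtracts from the residual a multiple of column \<open>k\<close>, namely
  \<open>\<nu>\<close> times its current correlation. As this column has norm one, its correlation
  shrinks by the factor \<open>1 - \<nu>\<close>; that of column \<open>j\<close> drops by the inner
  product of the two columns times what column \<open>k\<close> loses.\<close>

lemma residual_inner_descent:
  fixes X :: "real^'p^'n"
  assumes "standardized y X"
  shows "column k X \<bullet> (y - descent y X \<nu> k F0 m) = (1 - \<nu>) ^ m * (column k X \<bullet> (y - F0))"
    and "column j X \<bullet> (y - descent y X \<nu> k F0 m) = column j X \<bullet> (y - F0)
      - (column j X \<bullet> column k X) * (1 - (1 - \<nu>) ^ m) * (column k X \<bullet> (y - F0))"
proof (induction m)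
  case (Suc m)
  have step: "y - descent y X \<nu> k F0 (Suc m) = (y - descent y X \<nu> k F0 m)
      - (\<nu> * (column k X \<bullet> (y - descent y X \<nu> k F0 m))) *\<^sub>R column k X"
    by simp
  have self: "column k X \<bullet> column k X = 1"
    using assms by (rule standardized_column_inner_self)
  { case 1
    show ?case
      \<comment> \<open>The instantiation splits only the outer difference, so the residual stays
        whole for \<open>Suc.IH\<close>.\<close>
      unfolding step inner_diff_right[of _ "y - descent y X \<nu> k F0 m"] inner_scaleR_right self Suc.IH
      by (simp add: algebra_simps) }
  { case 2
    show ?case
      unfolding step inner_diff_right[of _ "y - descent y X \<nu> k F0 m"] inner_scaleR_right Suc.IH
      by (simp add: algebra_simps) }
qed simp_all

text \<open>Since \<open>\<bar>R * t\<bar> \<le> t\<close>, the modulus can exceed \<open>t\<close>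
  only if \<open>\<delta> + R * t\<close> has the sign of \<open>\<delta>\<close>, which makes the
  inequality linear in \<open>t\<close>.\<close>

lemma less_abs_affine_iff:
  fixes R \<delta> t :: real
  assumes "\<bar>R\<bar> < 1" "\<delta> \<noteq> 0" "0 \<le> t"
  shows "t < \<bar>\<delta> + R * t\<bar> \<longleftrightarrow> t < \<bar>\<delta>\<bar> / (1 - R * sgn \<delta>)"
proof -
  have Rt: "\<bar>R * t\<bar> \<le> t"
    using assms mult_right_mono[of "\<bar>R\<bar>" 1 t] by (simp add: abs_mult)
  have pos: "0 < 1 - R * sgn \<delta>"
    using assms by (cases "0 < \<delta>") auto
  have "t < \<bar>\<delta> + R * t\<bar> \<longleftrightarrow> t * (1 - R * sgn \<delta>) < \<bar>\<delta>\<bar>"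
    using assms Rt by (cases "0 < \<delta>") (auto simp: algebra_simps)
  then show ?thesis
    using pos by (simp add: pos_less_divide_eq)
qed

lemma power_crossing_exists:
  fixes u c :: real
  assumes "0 \<le> u" "u < 1" "0 < c" "c \<le> 1"
  obtains m where "1 \<le> m" "c \<le> u ^ (m - 1)" "u ^ m < c"
proof -
  have ex: "\<exists>n. u ^ n < c"
    using assms real_arch_pow_inv[of c u] by blast
  define m where "m = (LEAST n. u ^ n < c)"
  have below: "u ^ m < c"
    unfolding m_def using ex by (rule LeastI_ex)
  \<comment> \<open>Exponent 0 is excluded by \<open>c \<le> 1 = u ^ 0\<close>, also for
    \<open>u = 0\<close>.\<close>
  then have "1 \<le> m"
    using assms by (cases m) auto
  moreover have "c \<le> u ^ (m - 1)"
    using not_less_Least[of "m - 1" "\<lambda>n. u ^ n < c"] \<open>1 \<le> m\<close> by (simp add: m_def)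
  ultimately show thesis
    using below that by blast
qed

text \<open>Maximality is claimed among all integers, hence \<open>powi\<close>. Any
  \<open>i > m\<close> has exponent at least \<open>m\<close>, in the range of natural powers, which
  decrease.\<close>

lemma powi_ge_imp_le_crossing:
  fixes u c :: real and i :: int
  assumes "0 \<le> u" "u < 1" "u ^ m < c" "c \<le> u powi (i - 1)"
  shows "i \<le> int m"
proof (rule ccontr)
  assume "\<not> i \<le> int m"
  then have le: "m \<le> nat (i - 1)" and "0 \<le> i - 1" by auto
  then have "u powi (i - 1) = u ^ nat (i - 1)"
    by (simp add: power_int_def)
  also have "\<dots> \<le> u ^ m"
    using assms le by (intro power_decreasing) auto
  finally show False
    using assms by simp
qed

lemma power_crossing_unique:
  fixes u c :: real
  assumes "0 \<le> u" "u < 1" "1 \<le> m" "1 \<le> n"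
    and "c \<le> u ^ (m - 1)" "u ^ m < c" "c \<le> u ^ (n - 1)" "u ^ n < c"
  shows "m = n"
proof -
  have "u powi (int l - 1) = u ^ (l - 1)" if "1 \<le> l" for l
    using that by (simp add: power_int_def nat_diff_distrib)
  then show ?thesis
    using powi_ge_imp_le_crossing[of u m c "int n"] powi_ge_imp_le_crossing[of u n c "int m"] assms
    by simp
qed

text \<open>Taking logarithms and dividing by \<open>ln u < 0\<close> reverses both inequalities and
  traps the quotient in [m - 1, m).\<close>

lemma floor_log_crossing:
  fixes u c :: real
  assumes "0 < u" "u < 1" "0 < c" "1 \<le> m" "c \<le> u ^ (m - 1)" "u ^ m < c"
  shows "\<lfloor>1 + ln c / ln u\<rfloor> = int m"
proof -
  have neg: "ln u < 0"
    using assms by simp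
  have "ln c \<le> ln (u ^ (m - 1))" "ln (u ^ m) < ln c"
    using assms by (simp_all only: ln_le_cancel_iff ln_less_cancel_iff zero_less_power)
  then have "ln c \<le> (real m - 1) * ln u" "real m * ln u < ln c"
    using assms by (simp_all add: ln_realpow of_nat_diff)
  then have "real m - 1 \<le> ln c / ln u" "ln c / ln u < real m"
    using neg by (simp_all add: neg_le_divide_eq neg_divide_less_eq)
  then show ?thesis
    by (intro floor_unique) auto
qed

theorem theorem2:
  fixes y :: "real^'n" and X :: "real^'p^'n" and F0 :: "real^'n"
    and \<nu> R d c :: real and j k :: 'p and M :: enat
  assumes "standardized y X"
    and "0 < \<nu>" "\<nu> \<le> 1"
    and "\<bar>column k X \<bullet> (y - F0)\<bar> = Max (range (\<lambda>i. \<bar>column i X \<bullet> (y - F0)\<bar>))"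
    and "column k X \<bullet> (y - F0) \<noteq> 0"
    and "j \<noteq> k"
    and R: "R = column j X \<bullet> column k X"
    and d: "d = grad_corr y X \<nu> k F0 j 1 / grad_corr y X \<nu> k F0 k 1"
    and c: "c = \<bar>d - R\<bar> / (1 - R * sgn (d - R))"
    and M: "M = num_steps y X \<nu> k F0 j"
  shows "(\<forall>m\<ge>1. more_favorable_next y X \<nu> k F0 j m \<longleftrightarrow> M = enat m) \<and>
    (d \<noteq> R \<longrightarrow> (\<exists>m. M = enat m \<and> (1 - \<nu>) powi (int m - 1) \<ge> c \<and>
                  (\<forall>i::int. (1 - \<nu>) powi (i - 1) \<ge> c \<longrightarrow> i \<le> int m))) \<and>
    (d = R \<longrightarrow> M = \<infinity> \<and> (\<forall>i::int. i \<ge> 1 \<longrightarrow> (1 - \<nu>) powi (i - 1) \<ge> c)) \<and>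
    (\<nu> < 1 \<longrightarrow> ereal_of_enat M =
       efloor (1 + (eln \<bar>d - R\<bar> - eln (1 - R * sgn (d - R))) / eln (1 - \<nu>)))"
proof -
  define u where "u = 1 - \<nu>"
  define r where "r = column k X \<bullet> (y - F0)"
  define fav where "fav m \<longleftrightarrow> more_favorable_next y X \<nu> k F0 j m" for m
  have u: "0 \<le> u" "u < 1"
    using assms(2,3) by (auto simp: u_def)
  have r: "r \<noteq> 0"
    using assms(5) by (simp add: r_def)
  have jr: "column j X \<bullet> (y - F0) = d * r"
    using r by (simp add: d grad_corr_def r_def)
  \<comment> \<open>Maximality of direction \<open>k\<close> enters here.\<close>
  have "\<bar>column j X \<bullet> (y - F0)\<bar> \<le> \<bar>r\<bar>"
    unfolding r_def assms(4) by (rule Max_ge) auto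
  then have d1: "\<bar>d\<bar> \<le> 1"
    using r by (simp add: jr abs_mult)
  note unit = standardized_column_inner_self[OF assms(1)]
  \<comment> \<open>If |R| = 1, the two columns are equal or opposite, and then
    \<open>d = R\<close>.\<close>
  have R1: "\<bar>R\<bar> < 1" if "d \<noteq> R"
  proof (rule ccontr)
    assume "\<not> \<bar>R\<bar> < 1"
    then consider "R = 1" | "R = -1"
      using unit_inner_abs_le_one[OF unit unit, of j k] by (fastforce simp: R)
    then show False
    proof cases
      case 1
      then have "column j X = column k X"
        using unit_inner_eq_one[OF unit unit] by (simp add: R)
      then show False
        using that jr r 1 by (simp add: r_def)
    next
      case 2
      then have "column j X = - column k X"
        using unit_inner_eq_one[of "column j X" "- column k X"] unit by (simp add: R)
      then have "(d + 1) * r = 0"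
        using jr by (simp add: r_def algebra_simps)
      then show False
        using that r 2 by simp
    qed
  qed
  have corr_k: "grad_corr y X \<nu> k F0 k m = u ^ (m - 1) * r" for m
    by (simp add: grad_corr_def residual_inner_descent(1)[OF assms(1)] u_def r_def)
  have corr_j: "grad_corr y X \<nu> k F0 j m = ((d - R) + R * u ^ (m - 1)) * r" for m
    unfolding grad_corr_def residual_inner_descent(2)[OF assms(1)] jr
    by (simp add: u_def r_def R algebra_simps)
  have smaller_iff: "\<bar>grad_corr y X \<nu> k F0 k m\<bar> < \<bar>grad_corr y X \<nu> k F0 j m\<bar>
      \<longleftrightarrow> u ^ (m - 1) < \<bar>(d - R) + R * u ^ (m - 1)\<bar>" for m
    using r u by (simp add: corr_k corr_j abs_mult)
  have M_Inf: "M = Inf {enat m | m. 1 \<le> m \<and> fav m}"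
    by (simp add: M num_steps_def fav_def)
  show ?thesis
  proof (cases "d = R")
    case True
    \<comment> \<open>Both correlations now decay at the same rate, so \<open>j\<close> never
      overtakes \<open>k\<close>.\<close>
    have "\<bar>R * u ^ n\<bar> \<le> u ^ n" for n
      using d1 u True mult_right_mono[of "\<bar>R\<bar>" 1 "u ^ n"] by (simp add: abs_mult)
    then have "\<not> fav m" for m
      unfolding fav_def more_favorable_next_def smaller_iff using True
      by (simp add: not_less)
    then have no: "\<not> fav m" and inf: "M = \<infinity>" for m
      by (simp_all add: M_Inf top_enat_def)
    \<comment> \<open>Here \<open>c = 0\<close>, so every power passes the threshold.\<close>
    have "0 \<le> (1 - \<nu>) powi i" for i
      using u by (simp add: u_def)
    moreover have "ereal_of_enat M =
        efloor (1 + (eln \<bar>d - R\<bar> - eln (1 - R * sgn (d - R))) / eln (1 - \<nu>))" if "\<nu> < 1"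
    proof -
      \<comment> \<open>The numerator is -\<infinity> minus 0; the negative denominator turns the
        quotient into \<infinity>, which \<open>efloor\<close> fixes.\<close>
      have "eln (1 - \<nu>) = ereal (ln u)" "ln u < 0"
        using that u by (simp_all add: eln_def u_def)
      then show ?thesis
        using True inf by (simp add: eln_def efloor_def divide_ereal_def)
    qed
    ultimately show ?thesis
      using True no inf by (simp add: c fav_def)
  next
    case False
    have R1': "\<bar>R\<bar> < 1"
      using False by (rule R1)
    have den: "0 < 1 - R * sgn (d - R)"
      using False R1' by (cases "R < d") auto
    have c0: "0 < c"
      using False den by (simp add: c)
    \<comment> \<open>After clearing the denominator the terms in \<open>R\<close> cancel, leaving
      \<open>\<bar>d\<bar> \<le> 1\<close>.\<close>
    have c1: "c \<le> 1"
      using False den d1 by (cases "R < d") (auto simp: c)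
    have crossed: "\<bar>grad_corr y X \<nu> k F0 k m\<bar> < \<bar>grad_corr y X \<nu> k F0 j m\<bar> \<longleftrightarrow> u ^ (m - 1) < c" for m
      unfolding smaller_iff c using less_abs_affine_iff[OF R1', of "d - R"] False u by simp
    \<comment> \<open>The correlations at step \<open>m + 1\<close> carry the power
      \<open>u ^ m\<close>, so favorability is exactly a crossing of \<open>c\<close>.\<close>
    have fav_iff: "fav m \<longleftrightarrow> c \<le> u ^ (m - 1) \<and> u ^ m < c" for m
      using crossed[of m] crossed[of "m + 1"]
      by (auto simp: fav_def more_favorable_next_def)
    obtain m where m: "1 \<le> m" "c \<le> u ^ (m - 1)" "u ^ m < c"
      using power_crossing_exists[OF u c0 c1] .
    have fav_only: "fav n \<longleftrightarrow> n = m" if "1 \<le> n" for n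
      using power_crossing_unique[OF u that m(1)] m by (auto simp: fav_iff)
    then have "{enat n | n. 1 \<le> n \<and> fav n} = {enat m}"
      using m(1) by auto
    then have Mm: "M = enat m"
      by (simp add: M_Inf)
    have "u powi (int m - 1) = u ^ (m - 1)"
      using m(1) by (simp add: power_int_def nat_diff_distrib)
    then have "c \<le> (1 - \<nu>) powi (int m - 1)"
      using m by (simp add: u_def)
    moreover have "i \<le> int m" if "c \<le> (1 - \<nu>) powi (i - 1)" for i
      using powi_ge_imp_le_crossing[OF u m(3)] that by (simp add: u_def)
    moreover have "ereal_of_enat M =
        efloor (1 + (eln \<bar>d - R\<bar> - eln (1 - R * sgn (d - R))) / eln (1 - \<nu>))" if "\<nu> < 1"
    proof -
      have u0: "0 < u"
        using that by (simp add: u_def)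
      have "eln (1 - \<nu>) = ereal (ln u)" "ln u \<noteq> 0"
        using u0 u by (simp_all add: eln_def u_def)
      moreover have "eln \<bar>d - R\<bar> - eln (1 - R * sgn (d - R)) = ereal (ln c)"
        using False den by (simp add: eln_def c ln_div)
      ultimately have "1 + (eln \<bar>d - R\<bar> - eln (1 - R * sgn (d - R))) / eln (1 - \<nu>)
          = ereal (1 + ln c / ln u)"
        by (simp add: one_ereal_def)
      then show ?thesis
        using floor_log_crossing[OF u0 u(2) c0 m] by (simp add: efloor_def Mm)
    qed
    ultimately show ?thesis
      using False fav_only Mm by (auto simp: fav_def)
  qed
qed

end
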